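(* Let $\varphi,\varphi',\psi,\psi'\colon K\to L$ be simplicial maps. If $\varphi\sim\varphi'$ and $\psi\sim\psi'$, then $\mathrm{SimpD}(\varphi,\psi)=\mathrm{SimpD}(\varphi',\psi')$.
   Context: $K,L$ are (ordered) simplicial complexes: abstract simplicial complexes with a partial order on the vertices restricting to a total order on each simplex. A simplicial map is a map of vertices sending simplices to simplices. Contiguity: simplicial maps $\varphi,\psi\colon K\to L$ are contiguous if for every simplex $\sigma$ of $K$, $\varphi(\sigma)\cup\psi(\sigma)$ is a simplex of $L$. For $c\in\mathbb{Z}_{\ge0}$, they are $c$-contiguous ($\varphi\sim_c\psi$) if there are simplicial maps $H_0,\dots,H_c\colon K\to L$ with $H_0=\varphi$, $H_c=\psi$ and each pair $(H_{i-1},H_i)$ contiguous, $1\le i\le c$. We write $\varphi\sim\psi$ (same contiguity class) if $\varphi\sim_c\psi$ for some $c\ge 0$. Subdivisions: $\mathrm{Sd}^b(K)$ is the $b$-th iterated barycentric subdivision ($\mathrm{Sd}^0(K)=K$). For each $b\ge 0$ a simplicial approximation $\iota\colon\mathrm{Sd}^{b+1}(K)\to\mathrm{Sd}^b(K)$ of the identity of the realization $\|K\|$ is fixed (i.e. a simplicial map sending each vertex of $\mathrm{Sd}^{b+1}(K)$, regarded as a simplex $\sigma$ of $\mathrm{Sd}^b(K)$, to a vertex of $\sigma$); composites of these are also denoted $\iota\colon \mathrm{Sd}^b(K)\to K$. Simplicial distance: for simplicial maps $\varphi,\psi\colon K\to L$ and $b,c\in\mathbb{Z}_{\ge0}$,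 $\mathrm{SimpD}^b_c(\varphi,\psi)$ is the least integer $k\ge0$ such that there are subcomplexes $J_0,\dots,J_k$ covering $\mathrm{Sd}^b(K)$ for which the composites $J_i\hookrightarrow\mathrm{Sd}^b(K)\xrightarrow{\iota}K\xrightarrow{\varphi}L$ and $J_i\hookrightarrow\mathrm{Sd}^b(K)\xrightarrow{\iota}K\xrightarrow{\psi}L$ are $c$-contiguous for each $i$; it is $\infty$ if no such $k$ exists. It is non-increasing in $c$; $\mathrm{SimpD}^b(\varphi,\psi)$ denotes its stable value as $c\to\infty$. The sequence $\mathrm{SimpD}^b(\varphi,\psi)$ is non-increasing in $b$; $\mathrm{SimpD}(\varphi,\psi)$ denotes its stable value as $b\to\infty$. *)

theory Defs
  imports "HOL-Library.FSet" "HOL-Library.Extended_Nat"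
begin

section \<open>Simplicial complexes and simplicial maps\<close>

definition simplicial_complex :: "'a set set \<Rightarrow> bool" where
  "simplicial_complex K \<longleftrightarrow>
     (\<forall>\<sigma>\<in>K. finite \<sigma> \<and> \<sigma> \<noteq> {}) \<and> (\<forall>\<sigma>\<in>K. \<forall>\<tau>. \<tau> \<subseteq> \<sigma> \<and> \<tau> \<noteq> {} \<longrightarrow> \<tau> \<in> K)"

abbreviation (input) vertices :: "'a set set \<Rightarrow> 'a set" where
  "vertices K \<equiv> \<Union>K"

definition ordered_simplicial_complex :: "'a set set \<Rightarrow> 'a rel \<Rightarrow> bool" where
  "ordered_simplicial_complex K r \<longleftrightarrow>
     simplicial_complex K \<and> partial_order_on (vertices K) r \<and> (\<forall>\<sigma>\<in>K. total_on \<sigma> r)"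

definition subcomplex :: "'a set set \<Rightarrow> 'a set set \<Rightarrow> bool" where
  "subcomplex J K \<longleftrightarrow> simplicial_complex J \<and> J \<subseteq> K"

text \<open>A map of vertices is a total function, of which only the values on the vertices matter.
  Simplicial maps need not respect the vertex orders.\<close>

definition simplicial_map :: "'a set set \<Rightarrow> 'b set set \<Rightarrow> ('a \<Rightarrow> 'b) \<Rightarrow> bool" where
  "simplicial_map K L f \<longleftrightarrow> (\<forall>\<sigma>\<in>K. f ` \<sigma> \<in> L)"


section \<open>Contiguity\<close>

definition contiguous :: "'a set set \<Rightarrow> 'b set set \<Rightarrow> ('a \<Rightarrow> 'b) \<Rightarrow> ('a \<Rightarrow> 'b) \<Rightarrow> bool" where
  "contiguous K L f g \<longleftrightarrow>
     simplicial_map K L f \<and> simplicial_map K L g \<and> (\<forall>\<sigma>\<in>K. f ` \<sigma> \<union> g ` \<sigma> \<in> L)"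

text \<open>The ends of the chain are required to agree with the given maps on vertices only, since
  this is what equality of vertex maps means for total functions.  It matters when
  \<open>c = 0\<close> and for restrictions to subcomplexes.\<close>

definition c_contiguous ::
    "nat \<Rightarrow> 'a set set \<Rightarrow> 'b set set \<Rightarrow> ('a \<Rightarrow> 'b) \<Rightarrow> ('a \<Rightarrow> 'b) \<Rightarrow> bool" where
  "c_contiguous c K L f g \<longleftrightarrow>
     (\<exists>H :: nat \<Rightarrow> 'a \<Rightarrow> 'b.
        (\<forall>i\<le>c. simplicial_map K L (H i)) \<and>
        (\<forall>v\<in>vertices K. H 0 v = f v) \<and> (\<forall>v\<in>vertices K. H c v = g v) \<and>
        (\<forall>i\<in>{1..c}. contiguous K L (H (i - 1)) (H i)))"

definition same_contiguity_class ::
    "'a set set \<Rightarrow> 'b set set \<Rightarrow> ('a \<Rightarrow> 'b) \<Rightarrow> ('a \<Rightarrow> 'b) \<Rightarrow> bool" where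
  "same_contiguity_class K L f g \<longleftrightarrow> (\<exists>c. c_contiguous c K L f g)"


section \<open>Iterated barycentric subdivision\<close>

text \<open>A single type holding the vertices of all iterated subdivisions of a complex with vertices
  in \<^typ>\<open>'a\<close>: \<open>Pt v\<close> is the vertex \<open>v\<close> of the original complex, and
  \<open>Bary \<sigma>\<close> is the vertex of the next subdivision given by the simplex \<open>\<sigma>\<close>
  (simplices are finite).\<close>

datatype 'a vtx = Pt (unPt: 'a) | Bary "'a vtx fset"

text \<open>Meant for finite \<open>\<sigma>\<close> only.\<close>

definition bary :: "'a vtx set \<Rightarrow> 'a vtx" where
  "bary \<sigma> = Bary (Abs_fset \<sigma>)"

definition subdivision :: "'a vtx set set \<Rightarrow> 'a vtx set set" where
  "subdivision X = {bary ` C | C. C \<subseteq> X \<and> C \<noteq> {} \<and> finite C \<and> (\<forall>\<sigma>\<in>C. \<forall>\<tau>\<in>C. \<sigma> \<subseteq> \<tau> \<or> \<tau> \<subseteq> \<sigma>)}"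

text \<open>\<open>Sd 0 K\<close> is \<open>K\<close>, with each vertex \<open>v\<close> renamed to \<open>Pt v\<close>.\<close>

primrec Sd :: "nat \<Rightarrow> 'a set set \<Rightarrow> 'a vtx set set" where
  "Sd 0 K = (`) Pt ` K"
| "Sd (Suc b) K = subdivision (Sd b K)"

text \<open>A choice, for each \<open>b\<close>, of a simplicial approximation \<open>\<iota> b\<close> of the identity
  from \<open>Sd (Suc b) K\<close> to \<open>Sd b K\<close>.\<close>

definition simplicial_approximations :: "'a set set \<Rightarrow> (nat \<Rightarrow> 'a vtx \<Rightarrow> 'a vtx) \<Rightarrow> bool" where
  "simplicial_approximations K \<iota> \<longleftrightarrow>
     (\<forall>b. simplicial_map (Sd (Suc b) K) (Sd b K) (\<iota> b) \<and> (\<forall>\<sigma>\<in>Sd b K. \<iota> b (bary \<sigma>) \<in> \<sigma>))"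

text \<open>The composite from \<open>Sd b K\<close> to \<open>K\<close>.\<close>

primrec iota_comp :: "(nat \<Rightarrow> 'a vtx \<Rightarrow> 'a vtx) \<Rightarrow> nat \<Rightarrow> 'a vtx \<Rightarrow> 'a" where
  "iota_comp \<iota> 0 = unPt"
| "iota_comp \<iota> (Suc b) = iota_comp \<iota> b \<circ> \<iota> b"


section \<open>Simplicial distance\<close>

text \<open>The infimum in \<^typ>\<open>enat\<close> is the least element, and is \<open>\<infinity>\<close> for the empty set.\<close>

definition SimpD_bc :: "(nat \<Rightarrow> 'a vtx \<Rightarrow> 'a vtx) \<Rightarrow> 'a set set \<Rightarrow> 'b set set \<Rightarrow> nat \<Rightarrow> nat \<Rightarrow>
    ('a \<Rightarrow> 'b) \<Rightarrow> ('a \<Rightarrow> 'b) \<Rightarrow> enat" where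
  "SimpD_bc \<iota> K L b c \<phi> \<psi> =
     Inf {enat k | k. \<exists>J :: nat \<Rightarrow> 'a vtx set set.
       (\<forall>i\<le>k. subcomplex (J i) (Sd b K)) \<and> (\<Union>i\<le>k. J i) = Sd b K \<and>
       (\<forall>i\<le>k. c_contiguous c (J i) L (\<phi> \<circ> iota_comp \<iota> b) (\<psi> \<circ> iota_comp \<iota> b))}"

definition stable_value :: "(nat \<Rightarrow> 'a) \<Rightarrow> 'a" where
  "stable_value f = (THE v. \<exists>N. \<forall>n\<ge>N. f n = v)"

definition SimpD_b :: "(nat \<Rightarrow> 'a vtx \<Rightarrow> 'a vtx) \<Rightarrow> 'a set set \<Rightarrow> 'b set set \<Rightarrow> nat \<Rightarrow>
    ('a \<Rightarrow> 'b) \<Rightarrow> ('a \<Rightarrow> 'b) \<Rightarrow> enat" where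
  "SimpD_b \<iota> K L b \<phi> \<psi> = stable_value (\<lambda>c. SimpD_bc \<iota> K L b c \<phi> \<psi>)"

definition SimpD :: "(nat \<Rightarrow> 'a vtx \<Rightarrow> 'a vtx) \<Rightarrow> 'a set set \<Rightarrow> 'b set set \<Rightarrow>
    ('a \<Rightarrow> 'b) \<Rightarrow> ('a \<Rightarrow> 'b) \<Rightarrow> enat" where
  "SimpD \<iota> K L \<phi> \<psi> = stable_value (\<lambda>b. SimpD_b \<iota> K L b \<phi> \<psi>)"


section \<open>The stable values exist\<close>

lemma stable_value_eqI:
  assumes "\<And>n. n \<ge> N \<Longrightarrow> f n = v"
  shows "stable_value f = v"
  unfolding stable_value_def
proof (rule the_equality)
  show "\<exists>N. \<forall>n\<ge>N. f n = v" using assms by blast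
next
  fix w assume "\<exists>N. \<forall>n\<ge>N. f n = w"
  then obtain M where "\<forall>n\<ge>M. f n = w" by blast
  then have "f (max M N) = w" by simp
  with assms[of "max M N"] show "w = v" by simp
qed

lemma stable_value_antimono:
  fixes f :: "nat \<Rightarrow> enat"
  assumes "antimono f"
  shows "\<exists>N. \<forall>n\<ge>N. f n = stable_value f" and "stable_value f = (INF n. f n)"
proof -
  have "Inf (range f) \<in> range f"
    using wellorder_InfI[of "f 0" "range f"] by blast
  then obtain N where N: "f N = Inf (range f)" by (metis imageE)
  have eq: "f n = Inf (range f)" if "n \<ge> N" for n
  proof (rule antisym)
    show "f n \<le> Inf (range f)" using antimonoD[OF assms that] N by simp
  qed (simp add: Inf_lower)
  show *: "stable_value f = (INF n. f n)" by (rule stable_value_eqI[OF eq])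
  show "\<exists>N. \<forall>n\<ge>N. f n = stable_value f" using eq * by auto
qed

lemma simplicial_complex_Sd:
  assumes "simplicial_complex K"
  shows "simplicial_complex (Sd b K)"
proof (cases b)
  case 0
  have "\<tau> \<in> (`) Pt ` K" if "\<sigma> \<in> K" "\<tau> \<subseteq> Pt ` \<sigma>" "\<tau> \<noteq> {}" for \<sigma> \<tau>
  proof -
    obtain \<rho> where "\<rho> \<subseteq> \<sigma>" "\<tau> = Pt ` \<rho>" using \<open>\<tau> \<subseteq> Pt ` \<sigma>\<close> by (auto simp: subset_image_iff)
    moreover have "\<rho> \<noteq> {}" using \<open>\<tau> = Pt ` \<rho>\<close> \<open>\<tau> \<noteq> {}\<close> by simp
    ultimately have "\<rho> \<in> K" using conjunct2[OF assms[unfolded simplicial_complex_def]] \<open>\<sigma> \<in> K\<close>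
      by blast
    then show ?thesis using \<open>\<tau> = Pt ` \<rho>\<close> by simp
  qed
  moreover have "\<forall>\<sigma>\<in>(`) Pt ` K. finite \<sigma> \<and> \<sigma> \<noteq> {}"
    using assms unfolding simplicial_complex_def by simp
  ultimately show ?thesis unfolding 0 Sd.simps simplicial_complex_def by (metis imageE)
next
  case (Suc b')
  have "\<tau> \<in> subdivision X" if sub: "\<sigma> \<in> subdivision X" "\<tau> \<subseteq> \<sigma>" "\<tau> \<noteq> {}"
    for \<sigma> \<tau> and X :: "'a vtx set set"
  proof -
    obtain C where C: "\<sigma> = bary ` C" "C \<subseteq> X" "finite C" "\<forall>\<sigma>\<in>C. \<forall>\<tau>\<in>C. \<sigma> \<subseteq> \<tau> \<or> \<tau> \<subseteq> \<sigma>"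
      using sub(1) unfolding subdivision_def by blast
    obtain D where "D \<subseteq> C" "\<tau> = bary ` D" using sub(2) C(1) by (auto simp: subset_image_iff)
    moreover have "D \<noteq> {}" using \<open>\<tau> = bary ` D\<close> sub(3) by simp
    moreover have "finite D" using \<open>D \<subseteq> C\<close> C(3) by (rule finite_subset)
    moreover have "D \<subseteq> X" "\<forall>\<sigma>\<in>D. \<forall>\<tau>\<in>D. \<sigma> \<subseteq> \<tau> \<or> \<tau> \<subseteq> \<sigma>"
      using \<open>D \<subseteq> C\<close> C(2,4) by (meson subset_iff)+
    ultimately show ?thesis unfolding subdivision_def by blast
  qed
  moreover have "\<forall>\<sigma>\<in>subdivision X. finite \<sigma> \<and> \<sigma> \<noteq> {}" for X :: "'a vtx set set"
    unfolding subdivision_def by auto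
  ultimately show ?thesis unfolding Suc simplicial_complex_def by simp
qed

lemma c_contiguous_Suc:
  assumes "simplicial_complex K" "c_contiguous c K L f g"
  shows "c_contiguous (Suc c) K L f g"
proof -
  obtain H where H: "\<forall>i\<le>c. simplicial_map K L (H i)"
      "\<forall>v\<in>vertices K. H 0 v = f v" "\<forall>v\<in>vertices K. H c v = g v"
      "\<forall>i\<in>{1..c}. contiguous K L (H (i - 1)) (H i)"
    using assms(2) unfolding c_contiguous_def by blast
  have "contiguous K L (H (min c (i - 1))) (H (min c i))" if "i \<in> {1..Suc c}" for i
  proof (cases "i \<le> c")
    case True
    then have "min c (i - 1) = i - 1" "min c i = i" by auto
    then show ?thesis using H(4) that True by simp
  next
    case False
    then have "min c (i - 1) = c" "min c i = c" using that by auto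
    then show ?thesis using H(1) by (auto simp: contiguous_def simplicial_map_def)
  qed
  then show ?thesis using H unfolding c_contiguous_def
    by (intro exI[of _ "\<lambda>i. H (min c i)"]) auto
qed

lemma SimpD_bc_antimono: "antimono (\<lambda>c. SimpD_bc \<iota> K L b c \<phi> \<psi>)"
  unfolding antimono_iff_le_Suc SimpD_bc_def
  proof (intro allI Inf_superset_mono subsetI)
  fix c x
  assume "x \<in> {enat k | k. \<exists>J. (\<forall>i\<le>k. subcomplex (J i) (Sd b K)) \<and> (\<Union>i\<le>k. J i) = Sd b K \<and>
       (\<forall>i\<le>k. c_contiguous c (J i) L (\<phi> \<circ> iota_comp \<iota> b) (\<psi> \<circ> iota_comp \<iota> b))}"
  then obtain k J where kJ: "x = enat k" "\<forall>i\<le>k. subcomplex (J i) (Sd b K)" "(\<Union>i\<le>k. J i) = Sd b K"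
    "\<forall>i\<le>k. c_contiguous c (J i) L (\<phi> \<circ> iota_comp \<iota> b) (\<psi> \<circ> iota_comp \<iota> b)"
    by blast
  have "\<forall>i\<le>k. c_contiguous (Suc c) (J i) L (\<phi> \<circ> iota_comp \<iota> b) (\<psi> \<circ> iota_comp \<iota> b)"
    using kJ(2,4) by (simp add: subcomplex_def c_contiguous_Suc)
  with kJ(1-3) show "x \<in> {enat k | k. \<exists>J. (\<forall>i\<le>k. subcomplex (J i) (Sd b K)) \<and>
       (\<Union>i\<le>k. J i) = Sd b K \<and>
       (\<forall>i\<le>k. c_contiguous (Suc c) (J i) L (\<phi> \<circ> iota_comp \<iota> b) (\<psi> \<circ> iota_comp \<iota> b))}"
    by (intro CollectI exI[of _ k] conjI exI[of _ J])
qed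

lemma SimpD_bc_Suc:
  assumes "simplicial_complex K" "simplicial_approximations K \<iota>"
  shows "SimpD_bc \<iota> K L (Suc b) c \<phi> \<psi> \<le> SimpD_bc \<iota> K L b c \<phi> \<psi>"
  unfolding SimpD_bc_def
proof (rule Inf_superset_mono, safe)
  fix k :: nat and J :: "nat \<Rightarrow> 'a vtx set set"
  assume J: "\<forall>i\<le>k. subcomplex (J i) (Sd b K)" "(\<Union>i\<le>k. J i) = Sd b K"
    "\<forall>i\<le>k. c_contiguous c (J i) L (\<phi> \<circ> iota_comp \<iota> b) (\<psi> \<circ> iota_comp \<iota> b)"
  define J' where "J' i = {\<sigma> \<in> Sd (Suc b) K. \<iota> b ` \<sigma> \<in> J i}" for i
  have io: "\<iota> b ` \<sigma> \<in> Sd b K" if "\<sigma> \<in> Sd (Suc b) K" for \<sigma>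
    using assms(2) that unfolding simplicial_approximations_def simplicial_map_def by blast
  have "subcomplex (J' i) (Sd (Suc b) K)" if "i \<le> k" for i
  proof -
    have Ji: "simplicial_complex (J i)" using J(1) that unfolding subcomplex_def by blast
    have S: "simplicial_complex (Sd (Suc b) K)" by (rule simplicial_complex_Sd[OF assms(1)])
    have "\<tau> \<in> J' i" if "\<sigma> \<in> J' i" "\<tau> \<subseteq> \<sigma>" "\<tau> \<noteq> {}" for \<sigma> \<tau>
    proof -
      have "\<tau> \<in> Sd (Suc b) K" using that S unfolding simplicial_complex_def J'_def by blast
      moreover have "\<iota> b ` \<tau> \<subseteq> \<iota> b ` \<sigma>" "\<iota> b ` \<tau> \<noteq> {}" using that by auto
      then have "\<iota> b ` \<tau> \<in> J i" using that(1) Ji unfolding simplicial_complex_def J'_def by blast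
      ultimately show ?thesis unfolding J'_def by blast
    qed
    moreover have "J' i \<subseteq> Sd (Suc b) K" unfolding J'_def by (rule Collect_restrict)
    moreover have "\<forall>\<sigma>\<in>J' i. finite \<sigma> \<and> \<sigma> \<noteq> {}"
      using S \<open>J' i \<subseteq> Sd (Suc b) K\<close> unfolding simplicial_complex_def by (meson subsetD)
    ultimately show ?thesis unfolding subcomplex_def simplicial_complex_def by simp
  qed
  moreover have "(\<Union>i\<le>k. J' i) = Sd (Suc b) K"
    using io J(2) unfolding J'_def by blast
  moreover have "c_contiguous c (J' i) L (\<phi> \<circ> iota_comp \<iota> (Suc b)) (\<psi> \<circ> iota_comp \<iota> (Suc b))"
    if ik: "i \<le> k" for i
  proof -
    obtain H where H: "\<forall>j\<le>c. simplicial_map (J i) L (H j)"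
        "\<forall>v\<in>vertices (J i). H 0 v = (\<phi> \<circ> iota_comp \<iota> b) v"
        "\<forall>v\<in>vertices (J i). H c v = (\<psi> \<circ> iota_comp \<iota> b) v"
        "\<forall>j\<in>{1..c}. contiguous (J i) L (H (j - 1)) (H j)"
      using J(3)[rule_format, OF ik] unfolding c_contiguous_def by blast
    have v: "\<iota> b v \<in> vertices (J i)" if "v \<in> vertices (J' i)" for v
      using that unfolding J'_def by blast
    have "\<forall>v\<in>vertices (J' i). (H 0 \<circ> \<iota> b) v = (\<phi> \<circ> iota_comp \<iota> (Suc b)) v"
      using H(2)[rule_format, OF v] by simp
    moreover have "\<forall>v\<in>vertices (J' i). (H c \<circ> \<iota> b) v = (\<psi> \<circ> iota_comp \<iota> (Suc b)) v"
      using H(3)[rule_format, OF v] by simp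
    moreover have "simplicial_map (J' i) L (H j \<circ> \<iota> b)" if "j \<le> c" for j
      using H(1) that unfolding simplicial_map_def J'_def image_comp[symmetric] by simp
    moreover have "contiguous (J' i) L (H (j - 1) \<circ> \<iota> b) (H j \<circ> \<iota> b)" if "j \<in> {1..c}" for j
      using H(4) that unfolding contiguous_def simplicial_map_def J'_def image_comp[symmetric]
      by simp
    ultimately show ?thesis unfolding c_contiguous_def
      by (intro exI[of _ "\<lambda>j. H j \<circ> \<iota> b"] conjI) simp_all
  qed
  ultimately show "\<exists>k'. enat k = enat k' \<and> (\<exists>J. (\<forall>i\<le>k'. subcomplex (J i) (Sd (Suc b) K)) \<and>
      (\<Union>i\<le>k'. J i) = Sd (Suc b) K \<and>
      (\<forall>i\<le>k'. c_contiguous c (J i) L (\<phi> \<circ> iota_comp \<iota> (Suc b)) (\<psi> \<circ> iota_comp \<iota> (Suc b))))"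
    by (intro exI[of _ k] conjI exI[of _ J']) simp_all
qed

lemma SimpD_b_antimono:
  assumes "simplicial_complex K" "simplicial_approximations K \<iota>"
  shows "antimono (\<lambda>b. SimpD_b \<iota> K L b \<phi> \<psi>)"
  unfolding antimono_iff_le_Suc SimpD_b_def stable_value_antimono(2)[OF SimpD_bc_antimono]
  by (intro allI INF_mono' SimpD_bc_Suc[OF assms])

end

theory Submission
  imports Defs
begin

text \<open>A contiguity chain from \<open>\<phi>\<close> to \<open>\<phi>'\<close> pulls back along \<open>\<iota>\<close> to every subcomplex of a
  subdivision of \<open>K\<close>. So a cover \<open>J\<^sub>0, \<dots>, J\<^sub>k\<close> on which the pullbacks of \<open>\<phi>\<close> and \<open>\<psi>\<close> are
  contiguous works for \<open>\<phi>'\<close> and \<open>\<psi>'\<close> too, after lengthening the chains by a constant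
  that does not depend on the cover. The constant disappears in the limit \<open>c \<rightarrow> \<infinity>\<close>, so the
  distances already agree for each fixed \<open>b\<close>.\<close>

lemma contiguous_sym: "contiguous K L f g \<Longrightarrow> contiguous K L g f"
  by (simp add: contiguous_def Un_commute)

text \<open>Ends of chains are fixed on vertices only, so two chains may meet in functions that
  differ elsewhere. This lemma lets one be replaced by the other.\<close>

lemma contiguous_cong:
  assumes "\<And>v. v \<in> vertices K \<Longrightarrow> f v = f' v" "\<And>v. v \<in> vertices K \<Longrightarrow> g v = g' v"
  shows "contiguous K L f g \<longleftrightarrow> contiguous K L f' g'"
proof -
  have "f ` \<sigma> = f' ` \<sigma>" "g ` \<sigma> = g' ` \<sigma>" if "\<sigma> \<in> K" for \<sigma>
    using assms that by (auto intro!: image_cong)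
  then show ?thesis by (simp add: contiguous_def simplicial_map_def)
qed

lemma c_contiguous_sym:
  assumes "c_contiguous c K L f g"
  shows "c_contiguous c K L g f"
proof -
  obtain H where H: "\<forall>i\<le>c. simplicial_map K L (H i)"
      "\<forall>v\<in>vertices K. H 0 v = f v" "\<forall>v\<in>vertices K. H c v = g v"
      "\<forall>i\<in>{1..c}. contiguous K L (H (i - 1)) (H i)"
    using assms unfolding c_contiguous_def by blast
  have "contiguous K L (H (c - (i - 1))) (H (c - i))" if "i \<in> {1..c}" for i
  proof -
    \<comment> \<open>Step \<open>i\<close> of the reversed chain is step \<open>c - (i - 1)\<close>
      of \<open>H\<close> read backwards.\<close>
    have "c - (i - 1) \<in> {1..c}" "c - (i - 1) - 1 = c - i" using that by auto
    then show ?thesis using H(4) by (metis contiguous_sym)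
  qed
  then show ?thesis using H(1-3) unfolding c_contiguous_def
    by (intro exI[of _ "\<lambda>i. H (c - i)"]) auto
qed

lemma c_contiguous_trans:
  assumes "c_contiguous c K L f g" "c_contiguous d K L g h"
  shows "c_contiguous (c + d) K L f h"
proof -
  obtain H where H: "\<forall>i\<le>c. simplicial_map K L (H i)"
      "\<forall>v\<in>vertices K. H 0 v = f v" "\<forall>v\<in>vertices K. H c v = g v"
      "\<forall>i\<in>{1..c}. contiguous K L (H (i - 1)) (H i)"
    using assms(1) unfolding c_contiguous_def by blast
  obtain H' where H': "\<forall>i\<le>d. simplicial_map K L (H' i)"
      "\<forall>v\<in>vertices K. H' 0 v = g v" "\<forall>v\<in>vertices K. H' d v = h v"
      "\<forall>i\<in>{1..d}. contiguous K L (H' (i - 1)) (H' i)"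
    using assms(2) unfolding c_contiguous_def by blast
  \<comment> \<open>At the junction \<open>i = c\<close> the chain \<open>G\<close> takes
    \<open>H c\<close> rather than \<open>H' 0\<close>. Both agree with \<open>g\<close> on
    vertices, which is the case \<open>j = 0\<close> of \<open>G'\<close>.\<close>
  define G where "G i = (if i \<le> c then H i else H' (i - c))" for i
  have G': "G (c + j) v = H' j v" if "v \<in> vertices K" for j v
    using bspec[OF H(3) that] bspec[OF H'(2) that] by (cases j) (simp_all add: G_def)
  have "simplicial_map K L (G i)" if "i \<le> c + d" for i
    using that H(1) H'(1) by (simp add: G_def)
  moreover have "\<forall>v\<in>vertices K. G 0 v = f v" using H(2) by (simp add: G_def)
  moreover have "\<forall>v\<in>vertices K. G (c + d) v = h v" using G' H'(3) by simp
  moreover have "contiguous K L (G (i - 1)) (G i)" if i: "i \<in> {1..c + d}" for i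
  proof (cases "i \<le> c")
    case True
    then have "i - 1 \<le> c" by simp
    then show ?thesis using H(4) i True unfolding G_def by simp
  next
    case False
    define j where "j = i - c"
    have j: "j \<in> {1..d}" "i - 1 = c + (j - 1)" "i = c + j" using False i by (auto simp: j_def)
    have "contiguous K L (G (c + (j - 1))) (G (c + j)) \<longleftrightarrow> contiguous K L (H' (j - 1)) (H' j)"
      by (rule contiguous_cong) (fact G')+
    then show ?thesis using H'(4) j by simp
  qed
  ultimately show ?thesis unfolding c_contiguous_def by blast
qed

text \<open>Composing every map of the chain with \<open>p\<close> works because \<open>p\<close>
  sends simplices of \<open>J\<close> to simplices of \<open>K\<close>.\<close>

lemma c_contiguous_comp:
  assumes "c_contiguous c K L f g" "simplicial_map J K p"
  shows "c_contiguous c J L (f \<circ> p) (g \<circ> p)"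
proof -
  obtain H where H: "\<forall>i\<le>c. simplicial_map K L (H i)"
      "\<forall>v\<in>vertices K. H 0 v = f v" "\<forall>v\<in>vertices K. H c v = g v"
      "\<forall>i\<in>{1..c}. contiguous K L (H (i - 1)) (H i)"
    using assms(1) unfolding c_contiguous_def by blast
  have p: "p v \<in> vertices K" if "v \<in> vertices J" for v
    using that assms(2) unfolding simplicial_map_def by blast
  have "simplicial_map J L (H i \<circ> p)" if "i \<le> c" for i
    using H(1) that assms(2) unfolding simplicial_map_def image_comp[symmetric] by simp
  moreover have "contiguous J L (H (i - 1) \<circ> p) (H i \<circ> p)" if "i \<in> {1..c}" for i
    using H(4) that assms(2) unfolding contiguous_def simplicial_map_def image_comp[symmetric]
    by simp
  moreover have "\<forall>v\<in>vertices J. (H 0 \<circ> p) v = (f \<circ> p) v" "\<forall>v\<in>vertices J. (H c \<circ> p) v = (g \<circ> p) v"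
    using H(2)[rule_format, OF p] H(3)[rule_format, OF p] by simp_all
  ultimately show ?thesis unfolding c_contiguous_def
    by (intro exI[of _ "\<lambda>i. H i \<circ> p"]) simp
qed

lemma simplicial_map_iota_comp:
  assumes "simplicial_approximations K \<iota>"
  shows "simplicial_map (Sd b K) K (iota_comp \<iota> b)"
proof (induction b)
  case 0
  show ?case by (auto simp: simplicial_map_def image_image)
next
  case (Suc b)
  then show ?case using assms
    unfolding simplicial_approximations_def simplicial_map_def iota_comp.simps image_comp[symmetric]
    by blast
qed

text \<open>The cover, and hence \<open>k\<close>, is kept. Only the chain length grows, from
  \<open>c\<close> to \<open>m + (c + n)\<close>, so every \<open>k\<close> admissible on the right
  is admissible on the left.\<close>

lemma SimpD_bc_contiguous_le:
  assumes "simplicial_approximations K \<iota>"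
    and "c_contiguous m K L \<phi> \<phi>'" "c_contiguous n K L \<psi> \<psi>'"
  shows "SimpD_bc \<iota> K L b (m + (c + n)) \<phi>' \<psi>' \<le> SimpD_bc \<iota> K L b c \<phi> \<psi>"
proof -
  let ?p = "iota_comp \<iota> b"
  have *: "c_contiguous (m + (c + n)) J L (\<phi>' \<circ> ?p) (\<psi>' \<circ> ?p)"
    if J: "subcomplex J (Sd b K)" and c: "c_contiguous c J L (\<phi> \<circ> ?p) (\<psi> \<circ> ?p)" for J
  proof -
    have p: "simplicial_map J K ?p"
      using J simplicial_map_iota_comp[OF assms(1), of b]
      by (auto simp: subcomplex_def simplicial_map_def)
    \<comment> \<open>The chain runs from \<open>\<phi>'\<close> back to \<open>\<phi>\<close> in
      \<open>m\<close> steps, to \<open>\<psi>\<close> in \<open>c\<close> steps and on to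
      \<open>\<psi>'\<close> in \<open>n\<close> steps, all precomposed with
      \<open>?p\<close>.\<close>
    show ?thesis
      by (rule c_contiguous_trans[OF c_contiguous_sym c_contiguous_trans[OF c]])
        (fact c_contiguous_comp[OF assms(2) p] c_contiguous_comp[OF assms(3) p])+
  qed
  show ?thesis unfolding SimpD_bc_def
  proof (rule Inf_superset_mono, safe)
    fix k :: nat and J
    assume "\<forall>i\<le>k. subcomplex (J i) (Sd b K)" "(\<Union>i\<le>k. J i) = Sd b K"
      and "\<forall>i\<le>k. c_contiguous c (J i) L (\<phi> \<circ> ?p) (\<psi> \<circ> ?p)"
    with * show "\<exists>k'. enat k = enat k' \<and> (\<exists>J. (\<forall>i\<le>k'. subcomplex (J i) (Sd b K)) \<and>
        (\<Union>i\<le>k'. J i) = Sd b K \<and>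
        (\<forall>i\<le>k'. c_contiguous (m + (c + n)) (J i) L (\<phi>' \<circ> ?p) (\<psi>' \<circ> ?p)))"
      by (intro exI[of _ k] conjI exI[of _ J]) simp_all
  qed
qed

text \<open>By monotonicity in \<open>c\<close> the stable values are infima over all
  \<open>c\<close>. The term at \<open>c\<close> on the right is bounded below by the term at
  \<open>m + (c + n)\<close> on the left, so the shift in the index is harmless.\<close>

lemma SimpD_b_contiguous_le:
  assumes "simplicial_approximations K \<iota>"
    and "same_contiguity_class K L \<phi> \<phi>'" "same_contiguity_class K L \<psi> \<psi>'"
  shows "SimpD_b \<iota> K L b \<phi>' \<psi>' \<le> SimpD_b \<iota> K L b \<phi> \<psi>"
proof -
  obtain m n where "c_contiguous m K L \<phi> \<phi>'" "c_contiguous n K L \<psi> \<psi>'"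
    using assms(2,3) unfolding same_contiguity_class_def by blast
  note le = SimpD_bc_contiguous_le[OF assms(1) this]
  show ?thesis
    unfolding SimpD_b_def stable_value_antimono(2)[OF SimpD_bc_antimono]
    by (intro INF_mono bexI UNIV_I) (rule le)
qed

lemma same_contiguity_class_sym:
  "same_contiguity_class K L f g \<Longrightarrow> same_contiguity_class K L g f"
  unfolding same_contiguity_class_def using c_contiguous_sym by blast

theorem theorem3p6:
  fixes K :: "'a set set" and L :: "'b set set"
    and leK :: "'a rel" and leL :: "'b rel"
    and \<iota> :: "nat \<Rightarrow> 'a vtx \<Rightarrow> 'a vtx"
    and \<phi> \<phi>' \<psi> \<psi>' :: "'a \<Rightarrow> 'b"
  assumes "ordered_simplicial_complex K leK"
    and "ordered_simplicial_complex L leL"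
    and "simplicial_approximations K \<iota>"
    and "simplicial_map K L \<phi>" and "simplicial_map K L \<phi>'"
    and "simplicial_map K L \<psi>" and "simplicial_map K L \<psi>'"
    and "same_contiguity_class K L \<phi> \<phi>'"
    and "same_contiguity_class K L \<psi> \<psi>'"
  shows "SimpD \<iota> K L \<phi> \<psi> = SimpD \<iota> K L \<phi>' \<psi>'"
proof -
  have "SimpD_b \<iota> K L b \<phi> \<psi> = SimpD_b \<iota> K L b \<phi>' \<psi>'" for b
    \<comment> \<open>The inequality is applied twice, the second time with the roles of the two
      pairs exchanged.\<close>
    using SimpD_b_contiguous_le[OF assms(3)] assms(8,9) by (metis antisym same_contiguity_class_sym)
  then show ?thesis by (simp add: SimpD_def)
qed

end
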